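(* For any finite binary string $s$ that contains the symbol $1$, there exist a strongly connected directed graph $D$, a parallel chip-firing game on $D$, and a vertex $v$ of $D$ such that $s$ is the atomic firing sequence of $v$ in that game.
   Context: A directed graph $D=(V,E)$ is a finite set of vertices $V$ with a set $E$ of ordered pairs of vertices; $(u,v)\in E$ is an edge directed from $u$ to $v$, and the out-degree $\deg^+ v$ is the number of edges directed from $v$. It is strongly connected if there is a directed path in both directions between every pair of vertices. A parallel chip-firing game on $D$ starts with a finite nonnegative integer number of chips on each vertex. In each round, simultaneously, every vertex $v$ having at least $\deg^+ v$ chips fires, sending one chip along each of its outgoing edges; all other vertices wait. The game has period $T$ if $T$ is the smallest positive integer for which there is a round $t_0$ such that every vertex has the same number of chips in round $t$ as in round $t+T$ for all $t\ge t_0$. The least such $t_0$ is relabelled round $0$. Let $F_t(v)=1$ if $v$ fires in round $t$ and $F_t(v)=0$ otherwise. The atomic firing sequence of $v$ is the length-$T$ binary string $F_0(v)F_1(v)\cdots F_{T-1}(v)$, where $T$ is the period of the game. *)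

theory Defs
  imports "Graph_Theory.Digraph_Component" "Graph_Theory.Pair_Digraph"
begin

text \<open>
  A directed graph is a \<open>pair_fin_digraph\<close>: finitely many vertices and a set of ordered pairs of
  them as edges. Loops are not excluded. A chip configuration is a function into \<open>nat\<close>, of which
  only the values on the vertices of the graph are relevant.
\<close>

definition fires :: "'a pair_pre_digraph \<Rightarrow> ('a \<Rightarrow> nat) \<Rightarrow> 'a \<Rightarrow> bool" where
  "fires D c v \<longleftrightarrow> v \<in> pverts D \<and> out_degree (with_proj D) v \<le> c v"

definition chip_step :: "'a pair_pre_digraph \<Rightarrow> ('a \<Rightarrow> nat) \<Rightarrow> 'a \<Rightarrow> nat" where
  "chip_step D c v =
     c v - (if fires D c v then out_degree (with_proj D) v else 0)
         + card {u. (u, v) \<in> parcs D \<and> fires D c u}"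

definition chips :: "'a pair_pre_digraph \<Rightarrow> ('a \<Rightarrow> nat) \<Rightarrow> nat \<Rightarrow> 'a \<Rightarrow> nat" where
  "chips D c t = (chip_step D ^^ t) c"

definition periodic_from :: "'a pair_pre_digraph \<Rightarrow> ('a \<Rightarrow> nat) \<Rightarrow> nat \<Rightarrow> nat \<Rightarrow> bool" where
  "periodic_from D c T t0 \<longleftrightarrow>
     (\<forall>t \<ge> t0. \<forall>v \<in> pverts D. chips D c t v = chips D c (t + T) v)"

definition period :: "'a pair_pre_digraph \<Rightarrow> ('a \<Rightarrow> nat) \<Rightarrow> nat" where
  "period D c = (LEAST T. 0 < T \<and> (\<exists>t0. periodic_from D c T t0))"

definition first_periodic_round :: "'a pair_pre_digraph \<Rightarrow> ('a \<Rightarrow> nat) \<Rightarrow> nat" where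
  "first_periodic_round D c = (LEAST t0. periodic_from D c (period D c) t0)"

text \<open>
  Binary strings are lists of truth values, \<open>True\<close> being the symbol 1. Reading starts at
  \<open>first_periodic_round\<close>, the round which is relabelled as round 0.
\<close>

definition atomic_firing_sequence ::
  "'a pair_pre_digraph \<Rightarrow> ('a \<Rightarrow> nat) \<Rightarrow> 'a \<Rightarrow> bool list" where
  "atomic_firing_sequence D c v =
     map (\<lambda>t. fires D (chips D c (first_periodic_round D c + t)) v) [0..<period D c]"

text \<open>
  The number of chips is conserved, so every game on a finite directed graph is eventually
  periodic and both uses of \<open>LEAST\<close> above are well defined.
\<close>

lemma sum_chip_step:
  assumes "pair_fin_digraph D"
  shows "(\<Sum>v\<in>pverts D. chip_step D c v) = (\<Sum>v\<in>pverts D. c v)"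
proof -
  interpret pair_fin_digraph D by fact
  let ?V = "pverts D" and ?E = "parcs D"
  let ?F = "{e \<in> ?E. fires D c (fst e)}"
  let ?o = "\<lambda>v. if fires D c v then out_degree (with_proj D) v else 0"
  let ?i = "\<lambda>v. card {u. (u, v) \<in> ?E \<and> fires D c u}"
  have F: "finite ?F" using pair_finite_arcs by simp
  have out: "?o v = card {e \<in> ?F. fst e = v}" for v
    by (auto simp: out_degree_def out_arcs_def intro!: arg_cong[where f = card])
  have inn: "?i v = card {e \<in> ?F. snd e = v}" for v
  proof -
    have "{e \<in> ?F. snd e = v} = (\<lambda>u. (u, v)) ` {u. (u, v) \<in> ?E \<and> fires D c u}" by force
    then show ?thesis by (simp add: card_image inj_on_def)
  qed
  have "(\<Sum>v\<in>?V. ?o v) = card ?F"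
  proof -
    have "fst ` ?F \<subseteq> ?V" by (auto dest: in_arcsD1)
    from sum.group[OF F pair_finite_verts this, of "\<lambda>_. 1::nat"] show ?thesis
      unfolding out by simp
  qed
  moreover have "(\<Sum>v\<in>?V. ?i v) = card ?F"
  proof -
    have "snd ` ?F \<subseteq> ?V" by (auto dest: in_arcsD2)
    from sum.group[OF F pair_finite_verts this, of "\<lambda>_. 1::nat"] show ?thesis
      unfolding inn by simp
  qed
  moreover have "chip_step D c v + ?o v = c v + ?i v" for v
    by (auto simp: chip_step_def fires_def)
  then have "(\<Sum>v\<in>?V. chip_step D c v) + (\<Sum>v\<in>?V. ?o v) = (\<Sum>v\<in>?V. c v) + (\<Sum>v\<in>?V. ?i v)"
    by (simp add: sum.distrib[symmetric])
  ultimately show ?thesis by simp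
qed

lemma chips_Suc: "chips D c (Suc t) = chip_step D (chips D c t)"
  by (simp add: chips_def)

lemma chips_cong:
  assumes "pair_fin_digraph D" "\<forall>v\<in>pverts D. chips D c s v = chips D c t v"
  shows "\<forall>v\<in>pverts D. chips D c (s + n) v = chips D c (t + n) v"
proof (induction n)
  case (Suc n)
  interpret pair_fin_digraph D by fact
  have "fires D (chips D c (s + n)) = fires D (chips D c (t + n))"
    using Suc by (auto simp: fires_def fun_eq_iff)
  then show ?case using Suc by (simp add: chips_Suc chip_step_def)
qed (use assms in simp)

lemma eventually_periodic:
  assumes "pair_fin_digraph D"
  shows "\<exists>T>0. \<exists>t0. periodic_from D c T t0"
proof -
  interpret pair_fin_digraph D by fact
  let ?N = "\<Sum>v\<in>pverts D. c v"
  let ?g = "\<lambda>t. restrict (chips D c t) (pverts D)"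
  have "(\<Sum>v\<in>pverts D. chips D c t v) = ?N" for t
    by (induction t) (simp_all add: chips_Suc sum_chip_step[OF assms], simp add: chips_def)
  then have "chips D c t v \<le> ?N" if "v \<in> pverts D" for t v
    using member_le_sum[OF that, of "chips D c t"] pair_finite_verts by simp
  then have "range ?g \<subseteq> PiE (pverts D) (\<lambda>_. {..?N})" by auto
  then have "finite (range ?g)"
    by (rule finite_subset) (intro finite_PiE pair_finite_verts finite_atMost)
  then have "\<not> inj ?g" using finite_imageD infinite_UNIV_nat by blast
  then obtain s t where "s < t" and e: "?g s = ?g t"
    unfolding inj_def by (metis linorder_neqE_nat)
  have "\<forall>v\<in>pverts D. chips D c s v = chips D c t v"
    using e by (metis restrict_apply')
  from chips_cong[OF assms this] have h: "\<forall>v\<in>pverts D. chips D c (s + n) v = chips D c (t + n) v" for n .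
  have "periodic_from D c (t - s) s"
    unfolding periodic_from_def
  proof (intro allI impI ballI)
    fix r v assume "s \<le> r" "v \<in> pverts D"
    then show "chips D c r v = chips D c (r + (t - s)) v"
      using h[of "r - s"] \<open>s < t\<close> by (simp add: algebra_simps)
  qed
  with \<open>s < t\<close> show ?thesis by (intro exI[of _ "t - s"]) auto
qed

lemma period_pos_periodic:
  assumes "pair_fin_digraph D"
  shows "0 < period D c" "periodic_from D c (period D c) (first_periodic_round D c)"
proof -
  have "0 < period D c \<and> (\<exists>t0. periodic_from D c (period D c) t0)"
    unfolding period_def by (rule LeastI_ex) (use eventually_periodic[OF assms] in blast)
  then show "0 < period D c" "periodic_from D c (period D c) (first_periodic_round D c)"
    unfolding first_periodic_round_def by (auto intro: LeastI_ex)
qed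

end

theory Submission
  imports Defs
begin

text \<open>
  The vertex \<open>v\<close> is the output cell of a shift register, a directed path of cells of out-degree 1,
  each of which passes on its chip in the next round. The chips leaving the register are collected
  by a further vertex, which has an edge to the \<open>i\<close>-th cell iff the \<open>i\<close>-th symbol of the string is 1.
  It fires once in every period, when it has collected as many chips as the string has ones, and
  thereby reloads the register with the string. A chip takes one round to return from \<open>v\<close> to the
  collector and one to reach the register, so the collector fires at the right moment
  iff the last but one symbol of the string is 1. Rotating the string establishes this.
\<close>

locale shift_register =
  fixes p :: "bool list" and m :: nat
  assumes m_less: "m < length p" and p_m: "p ! m"
    and le_m: "\<And>i. i < length p \<Longrightarrow> p ! i \<Longrightarrow> i \<le> m"
    and p_last2: "p ! (length p - 2)" \<comment> \<open>for \<open>length p = 1\<close> this is \<open>p ! 0\<close>\<close>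
begin

text \<open>Cell 0 is the output, cell \<open>m\<close> is the far end, and \<open>length p\<close> is the collector.\<close>

definition G :: "nat pair_pre_digraph" where
  "G = \<lparr> pverts = insert (length p) {..m},
         parcs = insert (0, length p)
           ((\<lambda>i. (Suc i, i)) ` {..<m} \<union> Pair (length p) ` {i. i < length p \<and> p ! i}) \<rparr>"

text \<open>The configuration in phase \<open>j < length p\<close> of a cycle: the cells hold the
  string shifted by \<open>j\<close> places, and the collector holds the ones sent in phases before
  \<open>j\<close>. Its first summand is the chip sent by cell 0 in the last phase of the preceding
  cycle, which arrives when the collector has just fired.\<close>

definition state :: "nat \<Rightarrow> nat \<Rightarrow> nat" where
  "state j i =
     (if i < length p then of_bool (i + j < length p \<and> p ! (i + j))
      else if i = length p then of_bool (p ! (length p - 1)) + card {l. l < j \<and> p ! l}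
      else 0)"

lemma pverts_G: "pverts G = insert (length p) {..m}"
  by (simp add: G_def)

lemma finite_G: "pair_fin_digraph G"
  by unfold_locales (use m_less le_m in \<open>auto simp: G_def\<close>)

lemma out_degree_cell: "i \<le> m \<Longrightarrow> out_degree (with_proj G) i = 1"
proof -
  assume "i \<le> m"
  then have "out_arcs (with_proj G) i = {(i, if i = 0 then length p else i - 1)}"
    using m_less by (auto simp: out_arcs_def G_def image_iff gr0_conv_Suc)
  then show ?thesis by (simp add: out_degree_def)
qed

lemma out_degree_collector:
  "out_degree (with_proj G) (length p) = card {i. i < length p \<and> p ! i}"
proof -
  have "out_arcs (with_proj G) (length p) = Pair (length p) ` {i. i < length p \<and> p ! i}"
    using m_less by (auto simp: out_arcs_def G_def)
  then show ?thesis by (simp add: out_degree_def card_image inj_on_def)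
qed

lemma card_ones_Suc: "card {l. l < Suc j \<and> p ! l} = card {l. l < j \<and> p ! l} + of_bool (p ! j)"
proof (cases "p ! j")
  case True
  then have "{l. l < Suc j \<and> p ! l} = insert j {l. l < j \<and> p ! l}" by (auto simp: less_Suc_eq)
  with True show ?thesis by simp
next
  case False
  then have "{l. l < Suc j \<and> p ! l} = {l. l < j \<and> p ! l}" by (auto simp: less_Suc_eq)
  with False show ?thesis by simp
qed

lemma card_ones:
  "card {l. l < length p \<and> p ! l} =
     of_bool (p ! (length p - 1)) + card {l. l < length p - 1 \<and> p ! l}"
proof -
  have "Suc (length p - 1) = length p" using m_less by simp
  then show ?thesis using card_ones_Suc[of "length p - 1"] by simp
qed

text \<open>The 1 at \<open>length p - 2\<close> is counted on the right only. Hence the collector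
  stays below its out-degree until phase \<open>length p - 1\<close>.\<close>

lemma card_ones_less:
  assumes "j < length p - 1"
  shows "card {l. l < j \<and> p ! l} < card {l. l < length p - 1 \<and> p ! l}"
proof (rule psubset_card_mono)
  have "length p - 2 \<in> {l. l < length p - 1 \<and> p ! l}" "length p - 2 \<notin> {l. l < j \<and> p ! l}"
    using assms p_last2 by auto
  then show "{l. l < j \<and> p ! l} \<subset> {l. l < length p - 1 \<and> p ! l}"
    using assms by fastforce
qed simp

lemma fires_cell: "i \<le> m \<Longrightarrow> fires G (state j) i \<longleftrightarrow> i + j < length p \<and> p ! (i + j)"
  using m_less unfolding fires_def by (simp add: out_degree_cell state_def pverts_G)

lemma fires_collector:
  assumes "j < length p"
  shows "fires G (state j) (length p) \<longleftrightarrow> j = length p - 1"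
proof -
  have "length p \<in> pverts G" by (simp add: pverts_G)
  then show ?thesis
    using assms card_ones_less[of j] unfolding fires_def out_degree_collector card_ones
    by (cases "j < length p - 1") (auto simp: state_def)
qed

lemma fires_iff:
  assumes "j < length p"
  shows "fires G (state j) i \<longleftrightarrow>
    i \<le> m \<and> i + j < length p \<and> p ! (i + j) \<or> i = length p \<and> j = length p - 1"
proof -
  have "i \<le> m \<or> i = length p" if "fires G (state j) i"
    using that by (auto simp: fires_def pverts_G)
  then show ?thesis
    using fires_cell[of i j] fires_collector[OF assms] m_less by auto
qed

lemma chip_step_state:
  assumes j: "j < length p"
  shows "chip_step G (state j) = state (Suc j mod length p)"
proof
  fix i
  let ?n = "length p"
  let ?in = "{u. (u, i) \<in> parcs G \<and> fires G (state j) u}"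
  consider "i \<le> m" | "i = ?n" | "m < i" "i \<noteq> ?n" by linarith
  then show "chip_step G (state j) i = state (Suc j mod ?n) i"
  proof cases
    case 1
    \<comment> \<open>A chip due to enter cell \<open>i\<close> from the register does have a cell
      to come from, since no 1 lies beyond \<open>m\<close>.\<close>
    have "Suc i \<le> m" if "Suc (i + j) < ?n" "p ! Suc (i + j)"
      using le_m[OF that] by simp
    \<comment> \<open>In the last phase cell 0 is the only cell that can fire, and it feeds only the
      collector, so cell \<open>i\<close> is loaded by the collector alone. In every other phase the
      collector waits.\<close>
    then have "?in = (if j = ?n - 1 then if p ! i then {?n} else {}
                   else if Suc (i + j) < ?n \<and> p ! Suc (i + j) then {Suc i} else {})"
      using 1 m_less j by (auto simp: fires_iff[OF j]) (auto simp: G_def)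
    then show ?thesis
      using 1 m_less j by (auto simp: chip_step_def fires_cell out_degree_cell state_def mod_Suc)
  next
    case 2
    have "?in = (if p ! j then {0} else {})"
      using 2 m_less j by (auto simp: fires_iff[OF j]) (auto simp: G_def)
    \<comment> \<open>For \<open>j = length p - 1\<close> the collector spends all its chips, by
      \<open>card_ones\<close>, and keeps only what arrives from cell 0.\<close>
    then show ?thesis
      using 2 j card_ones
      by (auto simp: chip_step_def fires_collector out_degree_collector state_def mod_Suc card_ones_Suc)
  next
    case 3
    have "?in = {}" using 3 le_m by (force simp: G_def)
    moreover have "state j' i = 0" for j' using 3 le_m[of "i + j'"] by (auto simp: state_def)
    ultimately show ?thesis using 3 by (simp add: chip_step_def fires_iff[OF j])
  qed
qed

lemma chips_state:
  assumes "b < length p"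
  shows "chips G (state b) t = state ((b + t) mod length p)"
proof (induction t)
  case (Suc t)
  have "(b + t) mod length p < length p" using m_less by (intro mod_less_divisor) linarith
  with Suc show ?case by (simp add: chips_Suc chip_step_state mod_Suc_eq)
qed (use assms in \<open>simp add: chips_def\<close>)

lemma periodic_from_state: "b < length p \<Longrightarrow> periodic_from G (state b) (length p) 0"
  by (simp add: periodic_from_def chips_state flip: add.assoc)

text \<open>The collector fires in exactly one phase of a cycle. If it fires in some late round and
  again \<open>T\<close> rounds later, then \<open>T\<close> is a multiple of
  \<open>length p\<close>.\<close>

lemma period_state:
  assumes b: "b < length p"
  shows "period G (state b) = length p"
  unfolding period_def
proof (rule Least_equality)
  show "0 < length p \<and> (\<exists>t0. periodic_from G (state b) (length p) t0)"
    using b periodic_from_state by auto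
next
  fix T assume "0 < T \<and> (\<exists>t0. periodic_from G (state b) T t0)"
  then obtain t0 where "0 < T" and T: "periodic_from G (state b) T t0" by blast
  let ?n = "length p"
  \<comment> \<open>A round not before \<open>t0\<close> whose phase is the one in which the
    collector fires.\<close>
  define t where "t = t0 * ?n + (?n - 1 - b)"
  have "b + t = ?n - 1 + t0 * ?n" using b by (simp add: t_def)
  then have "(b + t) mod ?n = (?n - 1) mod ?n" by (simp only: mod_mult_self1)
  also have "\<dots> = ?n - 1" using b by (intro mod_less) linarith
  finally have t: "(b + t) mod ?n = ?n - 1" .
  have "t0 \<le> t" using b by (cases "?n") (auto simp: t_def)
  moreover have "?n \<in> pverts G" by (simp add: pverts_G)
  ultimately have "chips G (state b) t ?n = chips G (state b) (t + T) ?n"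
    using T unfolding periodic_from_def by blast
  then have "fires G (chips G (state b) t) ?n \<longleftrightarrow> fires G (chips G (state b) (t + T)) ?n"
    by (simp add: fires_def)
  moreover have "(b + t + T) mod ?n < ?n" using b by (intro mod_less_divisor) linarith
  ultimately have "(b + t + T) mod ?n = ?n - 1"
    using b t by (simp add: chips_state fires_collector add.assoc)
  with t have "(b + t + T) mod ?n = (b + t) mod ?n" by simp
  then have "?n dvd T" by (metis add_diff_cancel_left' le_add1 mod_eq_dvd_iff_nat)
  then show "?n \<le> T" using \<open>0 < T\<close> by (rule dvd_imp_le)
qed

lemma atomic_firing_sequence_output:
  assumes b: "b < length p"
  shows "atomic_firing_sequence G (state b) 0 = rotate b p"
proof -
  have "first_periodic_round G (state b) = 0"
    unfolding first_periodic_round_def period_state[OF b]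
    by (rule Least_equality) (use b periodic_from_state in auto)
  moreover have "(b + t) mod length p < length p" for t
    using m_less by (intro mod_less_divisor) linarith
  ultimately show ?thesis
    using b by (auto intro!: nth_equalityI
      simp: atomic_firing_sequence_def period_state chips_state fires_cell nth_rotate)
qed

text \<open>Every cell leads down to cell 0 and on to the collector, which reaches all cells through
  cell \<open>m\<close> because \<open>p ! m\<close> holds. A cell beyond \<open>m\<close> could not
  be reached from the collector, so the register ends at the last 1.\<close>

lemma strongly_connected_G: "strongly_connected (with_proj G)"
proof -
  interpret pair_fin_digraph G by (rule finite_G)
  let ?n = "length p"
  have arc: "u \<rightarrow>\<^sup>*\<^bsub>with_proj G\<^esub> v" if "(u, v) \<in> parcs G" for u v
    using that by (intro reachable_adjI) simp
  have down: "j + k \<le> m \<Longrightarrow> (j + k) \<rightarrow>\<^sup>*\<^bsub>with_proj G\<^esub> j" for j k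
  proof (induction k)
    case 0
    then show ?case by (simp add: pverts_G)
  next
    case (Suc k)
    then have "(j + Suc k) \<rightarrow>\<^sup>*\<^bsub>with_proj G\<^esub> (j + k)" by (intro arc) (simp add: G_def)
    moreover have "(j + k) \<rightarrow>\<^sup>*\<^bsub>with_proj G\<^esub> j" using Suc by simp
    ultimately show ?case by (rule reachable_trans)
  qed
  have to: "u \<rightarrow>\<^sup>*\<^bsub>with_proj G\<^esub> ?n" if "u \<in> pverts G" for u
  proof (cases "u = ?n")
    case False
    then have "u \<rightarrow>\<^sup>*\<^bsub>with_proj G\<^esub> 0" using that down[of 0 u] by (simp add: pverts_G)
    moreover have "0 \<rightarrow>\<^sup>*\<^bsub>with_proj G\<^esub> ?n" by (intro arc) (simp add: G_def)
    ultimately show ?thesis by (rule reachable_trans)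
  qed (use that in simp)
  have from_n: "?n \<rightarrow>\<^sup>*\<^bsub>with_proj G\<^esub> v" if "v \<in> pverts G" for v
  proof (cases "v = ?n")
    case False
    then have "m \<rightarrow>\<^sup>*\<^bsub>with_proj G\<^esub> v" using that down[of v "m - v"] by (simp add: pverts_G)
    moreover have "?n \<rightarrow>\<^sup>*\<^bsub>with_proj G\<^esub> m" using m_less p_m by (intro arc) (simp add: G_def)
    ultimately show ?thesis by (rule reachable_trans[rotated])
  qed (use that in simp)
  have "u \<rightarrow>\<^sup>*\<^bsub>with_proj G\<^esub> v" if "u \<in> pverts G" "v \<in> pverts G" for u v
    using to[OF that(1)] from_n[OF that(2)] by (rule reachable_trans)
  then show ?thesis by (intro strongly_connectedI) (simp_all add: pverts_G)
qed

end

lemma rotate_last_but_one: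
  assumes "True \<in> set s"
  obtains p b where "s = rotate b p" "b < length p" "p ! (length p - 2)"
proof -
  let ?n = "length s"
  obtain a where a: "a < ?n" "s ! a" using assms by (metis in_set_conv_nth)
  \<comment> \<open>Rotating left by \<open>a + 2\<close> moves the 1 at index \<open>a\<close> to
    index -2 modulo \<open>?n\<close>. The inverse rotation \<open>?b\<close> is -(a + 2) modulo
    \<open>?n\<close>, written so that the subtraction of naturals is not truncated.\<close>
  define p where "p = rotate (a + 2) s"
  let ?b = "(?n * (a + 2) - (a + 2)) mod ?n"
  have "a + 2 \<le> ?n * (a + 2)" using a by (cases ?n) auto
  then have "rotate ?b p = s"
    unfolding p_def by (metis rotate_conv_mod length_rotate rotate_rotate le_add_diff_inverse2
        rotate_id mod_mult_self1_is_0)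
  moreover have "p ! (?n - 2)"
  proof -
    have "p ! (?n - 2) = s ! ((a + 2 + (?n - 2)) mod ?n)"
      unfolding p_def using a by (intro nth_rotate) simp
    also have "(a + 2 + (?n - 2)) mod ?n = a"
    \<comment> \<open>For \<open>?n = 1\<close> the difference \<open>?n - 2\<close> is truncated to
      0, but modulo 1 this is harmless.\<close>
    proof (cases "?n = 1")
      case False
      then have "a + 2 + (?n - 2) = a + ?n" using a by linarith
      then show ?thesis using a by (simp only: mod_add_self2 mod_less)
    qed (use a in simp)
    finally show ?thesis using a by simp
  qed
  moreover have "?b < length p" using a by (cases s) (auto simp: p_def)
  ultimately show ?thesis using that[of ?b p] by (simp add: p_def)
qed

theorem theorem4p6:
  fixes s :: "bool list"
  assumes "True \<in> set s"
  shows "\<exists>(D :: nat pair_pre_digraph) (c :: nat \<Rightarrow> nat) v.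
           pair_fin_digraph D \<and> strongly_connected (with_proj D) \<and> v \<in> pverts D \<and>
           atomic_firing_sequence D c v = s"
proof -
  obtain p b where p: "s = rotate b p" "b < length p" "p ! (length p - 2)"
    using rotate_last_but_one[OF assms] .
  let ?I = "{i. i < length p \<and> p ! i}"
  have "length p - 2 \<in> ?I" using p by auto
  then have "Max ?I \<in> ?I" by (intro Max_in) auto
  then interpret shift_register p "Max ?I"
    by unfold_locales (use p in auto)
  show ?thesis
    using finite_G strongly_connected_G atomic_firing_sequence_output[OF p(2)] p(1)
    by (intro exI[of _ G] exI[of _ "state b"] exI[of _ 0]) (simp add: pverts_G)
qed

end
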